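(* Let $\mathbb{F}_q$ be a finite field that is indefinite and let $n\ge 1$. Let $\mathrm{pd}_2(n)$ be the number of positive definite matrices of type 2 in $\mathrm{GL}_n(\mathbb{F}_q)$, i.e. the number of symmetric matrices $A\in\mathrm{GL}_n(\mathbb{F}_q)$ such that $A=LL^T$ for some lower triangular matrix $L\in\mathrm{GL}_n(\mathbb{F}_q)$ all of whose diagonal entries are positive. Then $$\mathrm{pd}_2(n)=q^{\frac{n^2-n}{2}}\left(\frac{q-1}{4}\right)^n.$$
   Context: $q$ is a prime power and $\mathbb{F}_q$ is the field with $q$ elements. An element $a\in\mathbb{F}_q^\times$ is called positive if $a=b^2$ for some $b\in\mathbb{F}_q^\times$. A field $\mathbb{F}$ is called definite if for every positive element $a\in\mathbb{F}$ there exists a positive element $b\in\mathbb{F}$ with $a=b^2$; otherwise it is called indefinite. *)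

theory Defs
  imports Complex_Main "HOL-Library.Cardinality" "Jordan_Normal_Form.Matrix"
begin

definition positive :: "'a::field \<Rightarrow> bool" where
  "positive a \<longleftrightarrow> a \<noteq> 0 \<and> (\<exists>b. b \<noteq> 0 \<and> a = b ^ 2)"

definition definite_field :: "'a::field itself \<Rightarrow> bool" where
  "definite_field (_ :: 'a itself) \<longleftrightarrow>
     (\<forall>a::'a. positive a \<longrightarrow> (\<exists>b. positive b \<and> a = b ^ 2))"

abbreviation indefinite_field :: "'a::field itself \<Rightarrow> bool" where
  "indefinite_field K \<equiv> \<not> definite_field K"

definition GL :: "nat \<Rightarrow> 'a::field mat set" where
  "GL n = {A \<in> carrier_mat n n. invertible_mat A}"

definition symmetric_matrix :: "'a mat \<Rightarrow> bool" where
  "symmetric_matrix A \<longleftrightarrow> transpose_mat A = A"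

definition lower_triangular :: "'a::zero mat \<Rightarrow> bool" where
  "lower_triangular A \<longleftrightarrow> (\<forall>i < dim_row A. \<forall>j < dim_col A. i < j \<longrightarrow> A $$ (i, j) = 0)"

definition positive_definite_type2 :: "nat \<Rightarrow> 'a::field mat \<Rightarrow> bool" where
  "positive_definite_type2 n A \<longleftrightarrow>
     A \<in> GL n \<and> symmetric_matrix A \<and>
     (\<exists>L \<in> GL n. lower_triangular L \<and> (\<forall>i < n. positive (L $$ (i, i))) \<and>
        A = L * transpose_mat L)"

definition pd2 :: "'a::field itself \<Rightarrow> nat \<Rightarrow> nat" where
  "pd2 (_ :: 'a itself) n = card {A :: 'a mat. positive_definite_type2 n A}"

end

theory Submission
  imports Defs "HOL-Library.FuncSet" "Jordan_Normal_Form.Determinant"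
begin

text \<open>
  If the field is indefinite, then squaring is not injective on the finite set of positive
  elements, so \<open>-1 \<noteq> 1\<close> and \<open>-1\<close> is positive. Hence squaring is two-to-one both on the nonzero and on the
  positive elements, and there is a set \<open>R\<close> of \<open>(q - 1) / 4\<close> positive elements containing exactly one
  element of each pair of opposite positive elements. Changing signs of columns, every
  positive definite matrix of type 2 is \<open>L L\<^sup>T\<close> with \<open>L\<close> lower triangular and diagonal in \<open>R\<close>; such
  an \<open>L\<close> is unique, since its columns are recovered one after the other.
\<close>

section \<open>Squaring and signs in an indefinite finite field\<close>

text \<open>Each fibre of squaring on \<open>X\<close> is a pair \<open>{x, - x}\<close>, with two
  distinct members because \<open>2\<close> and \<open>x\<close> are nonzero.\<close>

lemma card_eq_double_card_squares:
  fixes X :: "'a::field set"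
  assumes fin: "finite X" and zero: "0 \<notin> X" and minus: "\<And>x. x \<in> X \<Longrightarrow> - x \<in> X"
    and neq: "(-1::'a) \<noteq> 1"
  shows "card X = 2 * card ((\<lambda>x. x\<^sup>2) ` X)"
proof -
  have two: "(2::'a) \<noteq> 0"
  proof
    assume "(2::'a) = 0"
    then have "(1::'a) + 1 = 0" by simp
    then show False using neq by (metis add_eq_0_iff)
  qed
  have fibre: "card {x \<in> X. x\<^sup>2 = y} = 2" if "y \<in> (\<lambda>x. x\<^sup>2) ` X" for y
  proof -
    from that obtain x where x: "x \<in> X" "y = x\<^sup>2" by auto
    have "{z \<in> X. z\<^sup>2 = y} = {x, - x}"
      using x minus by (auto simp: power2_eq_iff)
    moreover have "x \<noteq> - x"
    proof
      assume "x = - x"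
      then have "2 * x = 0" by (metis add.right_inverse mult_2)
      then show False using two x zero by auto
    qed
    ultimately show ?thesis by simp
  qed
  have "card X = (\<Sum>y \<in> (\<lambda>x. x\<^sup>2) ` X. card {x \<in> X. x\<^sup>2 = y})"
    using sum.image_gen[OF fin, of "\<lambda>_. 1::nat" "\<lambda>x. x\<^sup>2"] by simp
  also have "\<dots> = 2 * card ((\<lambda>x. x\<^sup>2) ` X)"
    using fibre by simp
  finally show ?thesis .
qed

lemma positive_mult: "positive a \<Longrightarrow> positive b \<Longrightarrow> positive (a * b)"
  unfolding positive_def by (metis mult_eq_0_iff power_mult_distrib)

lemma positive_divide: "positive a \<Longrightarrow> positive b \<Longrightarrow> positive (a / b)"
  unfolding positive_def by (metis divide_eq_0_iff power_divide)

text \<open>Squaring maps the finite set of positive elements into itself, so if injective it would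
  be onto, which is definiteness. Hence distinct positive \<open>x\<close>, \<open>y\<close> have
  equal squares, which forces \<open>y = - x\<close>, and -1 is the quotient \<open>y / x\<close> of
  positive elements.\<close>

lemma indefinite_imp_positive_minus_one:
  assumes indef: "indefinite_field TYPE('a::{field,finite})"
  shows "positive (-1::'a)" "(-1::'a) \<noteq> 1"
proof -
  let ?P = "{a::'a. positive a}"
  have sub: "(\<lambda>x. x\<^sup>2) ` ?P \<subseteq> ?P"
    by (auto simp: positive_def)
  have "\<not> inj_on (\<lambda>x. x\<^sup>2) ?P"
  proof
    assume "inj_on (\<lambda>x. x\<^sup>2) ?P"
    then have "(\<lambda>x. x\<^sup>2) ` ?P = ?P"
      using sub by (intro endo_inj_surj) auto
    then have "definite_field TYPE('a)"
      unfolding definite_field_def by blast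
    then show False using indef by simp
  qed
  then obtain x y :: 'a where xy: "positive x" "positive y" "x\<^sup>2 = y\<^sup>2" "x \<noteq> y"
    by (auto simp: inj_on_def)
  then have "y = - x" by (auto simp: power2_eq_iff)
  moreover have "x \<noteq> 0" using xy by (simp add: positive_def)
  ultimately have "-1 = y / x" by simp
  then show "positive (-1::'a)"
    using positive_divide xy by metis
  \<comment> \<open>If -1 were 1, then \<open>y / x = 1\<close> would contradict
    \<open>x \<noteq> y\<close>.\<close>
  show "(-1::'a) \<noteq> 1"
    using \<open>-1 = y / x\<close> xy \<open>x \<noteq> 0\<close> by auto
qed

lemma ex_positive_square_transversal:
  assumes indef: "indefinite_field TYPE('a::{field,finite})"
  obtains R :: "'a::{field,finite} set" where "\<And>r. r \<in> R \<Longrightarrow> positive r" "inj_on (\<lambda>x. x\<^sup>2) R"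
    "\<And>x. positive x \<Longrightarrow> x \<in> R \<or> - x \<in> R" "4 * card R = CARD('a) - 1"
proof -
  let ?sq = "\<lambda>x::'a. x\<^sup>2"
  let ?P = "{a::'a. positive a}"
  note minus = indefinite_imp_positive_minus_one[OF indef]
  \<comment> \<open>\<open>R\<close> chooses one positive square root of each square of a positive
    element.\<close>
  obtain R where R: "R \<subseteq> ?P" "inj_on ?sq R" "?sq ` ?P = ?sq ` R"
    using subset_image_inj[of "?sq ` ?P" ?sq ?P] by auto
  have neg: "positive (- x)" if "positive x" for x :: 'a
    using positive_mult[OF minus(1) that] by simp
  have P: "?P = ?sq ` (UNIV - {0})"
    by (auto simp: positive_def)
  \<comment> \<open>The factor 4 comes from halving twice: from nonzero to positive elements, and
    from these to their squares, which \<open>R\<close> represents.\<close>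
  have "CARD('a) - 1 = card (UNIV - {0::'a})"
    by (simp add: card_Diff_singleton)
  also have "\<dots> = 2 * card ?P"
    unfolding P using minus(2) by (intro card_eq_double_card_squares) auto
  also have "card ?P = 2 * card (?sq ` ?P)"
    using minus(2) neg by (intro card_eq_double_card_squares) (auto simp: positive_def)
  also have "?sq ` ?P = ?sq ` R" by (fact R(3))
  also have "card \<dots> = card R" using R(2) by (rule card_image)
  finally have "4 * card R = CARD('a) - 1" by simp
  moreover have "x \<in> R \<or> - x \<in> R" if "positive x" for x
  proof -
    have "x\<^sup>2 \<in> ?sq ` R" using that unfolding R(3)[symmetric] by blast
    then obtain r where "r \<in> R" "x\<^sup>2 = r\<^sup>2" by auto
    then show ?thesis by (auto simp: power2_eq_iff)
  qed
  ultimately show ?thesis using R that by blast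
qed

section \<open>Counting lower triangular matrices with prescribed diagonal entries\<close>

definition lower_triangular_mats :: "nat \<Rightarrow> 'a::zero set \<Rightarrow> 'a mat set" where
  "lower_triangular_mats n R =
     {L \<in> carrier_mat n n. lower_triangular L \<and> (\<forall>i < n. L $$ (i, i) \<in> R)}"

lemma card_lower_triangular_mats:
  fixes R :: "'a::{zero,finite} set"
  shows "card (lower_triangular_mats n R) = CARD('a) ^ (n * (n - 1) div 2) * card R ^ n"
proof -
  let ?I = "{..<n} \<times> {..<n}"
  \<comment> \<open>The entries vary independently, so the matrices correspond to a product of the
    sets \<open>B\<close> of admissible values.\<close>
  define B :: "nat \<times> nat \<Rightarrow> 'a set"
    where "B = (\<lambda>(i, j). if i < j then {0} else if i = j then R else UNIV)"
  have inj: "inj_on (mat n n) (PiE ?I B)"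
  proof (rule inj_onI)
    fix f g assume fg: "f \<in> PiE ?I B" "g \<in> PiE ?I B" "mat n n f = mat n n g"
    show "f = g"
    proof (rule PiE_ext[OF fg(1,2)])
      fix p assume "p \<in> ?I"
      then show "f p = g p"
        using arg_cong[OF fg(3), of "\<lambda>A. A $$ p"] by auto
    qed
  qed
  have img: "mat n n ` PiE ?I B = lower_triangular_mats n R"
  proof (intro equalityI subsetI)
    fix L assume "L \<in> mat n n ` PiE ?I B"
    then obtain f where f: "f \<in> PiE ?I B" "L = mat n n f" by blast
    have "f (i, j) \<in> B (i, j)" if "i < n" "j < n" for i j
      using f(1) that by (auto dest: PiE_mem)
    then show "L \<in> lower_triangular_mats n R"
      unfolding f(2) lower_triangular_mats_def lower_triangular_def B_def
      by (fastforce split: if_splits)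
  next
    fix L assume L: "L \<in> lower_triangular_mats n R"
    then have "L = mat n n (restrict (\<lambda>p. L $$ p) ?I)"
      by (intro eq_matI) (auto simp: lower_triangular_mats_def)
    moreover have "restrict (\<lambda>p. L $$ p) ?I \<in> PiE ?I B"
      using L by (auto simp: lower_triangular_mats_def lower_triangular_def B_def)
    ultimately show "L \<in> mat n n ` PiE ?I B" by (rule image_eqI)
  qed
  \<comment> \<open>Row \<open>i\<close>, counted from 0, has \<open>i\<close> free entries, one
    diagonal entry in \<open>R\<close>, and forced zeros after it.\<close>
  have row: "(\<Prod>j<n. card (B (i, j))) = CARD('a) ^ i * card R" if "i < n" for i
  proof -
    have "(\<Prod>j<n. card (B (i, j))) = (\<Prod>j \<in> {..<i} \<union> {i} \<union> {i<..<n}. card (B (i, j)))"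
      using that by (intro prod.cong) auto
    also have "\<dots> =
        (\<Prod>j<i. card (B (i, j))) * card (B (i, i)) * (\<Prod>j\<in>{i<..<n}. card (B (i, j)))"
      by (subst prod.union_disjoint; (subst prod.union_disjoint)?; auto)
    also have "\<dots> = CARD('a) ^ i * card R"
      by (simp add: B_def)
    finally show ?thesis .
  qed
  have "card (lower_triangular_mats n R) = card (PiE ?I B)"
    unfolding img[symmetric] by (rule card_image[OF inj])
  also have "\<dots> = (\<Prod>p\<in>?I. card (B p))"
    by (simp add: card_PiE)
  also have "\<dots> = (\<Prod>i<n. \<Prod>j<n. card (B (i, j)))"
    by (simp add: prod.cartesian_product)
  also have "\<dots> = (\<Prod>i<n. CARD('a) ^ i * card R)"
    using row by simp
  also have "\<dots> = CARD('a) ^ (\<Sum>i<n. i) * card R ^ n"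
    by (simp add: prod.distrib power_sum)
  also have "(\<Sum>i<n. i) = n * (n - 1) div 2"
    by (simp add: lessThan_atLeast0 Sum_Ico_nat)
  finally show ?thesis .
qed

section \<open>Uniqueness of the triangular factor\<close>

text \<open>Terms with \<open>k > j\<close> vanish since \<open>L $$ (j, k) = 0\<close>. Splitting
  off \<open>k = j\<close> isolates column \<open>j\<close> from the earlier columns, ready for
  induction.\<close>

lemma mult_transpose_index_lower_triangular:
  fixes L :: "'a::comm_ring_1 mat"
  assumes "L \<in> carrier_mat n n" "lower_triangular L" "i < n" "j < n"
  shows "(L * transpose_mat L) $$ (i, j) =
    (\<Sum>k<j. L $$ (i, k) * L $$ (j, k)) + L $$ (i, j) * L $$ (j, j)"
proof -
  have "(L * transpose_mat L) $$ (i, j) = (\<Sum>k<n. L $$ (i, k) * L $$ (j, k))"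
    using assms by (simp add: scalar_prod_def lessThan_atLeast0)
  also have "\<dots> = (\<Sum>k<Suc j. L $$ (i, k) * L $$ (j, k))"
    using assms by (intro sum.mono_neutral_right) (auto simp: lower_triangular_def)
  finally show ?thesis by simp
qed

text \<open>Once the earlier columns agree, the product determines
  \<open>L $$ (i, j) * L $$ (j, j)\<close>. The case \<open>i = j\<close> fixes the diagonal entry,
  as squaring is injective on \<open>R\<close>; cancelling this nonzero entry gives the rest of the
  column.\<close>

lemma inj_on_mult_transpose_lower_triangular_mats:
  fixes R :: "'a::field set"
  assumes zero: "0 \<notin> R" and inj: "inj_on (\<lambda>x. x\<^sup>2) R"
  shows "inj_on (\<lambda>L. L * transpose_mat L) (lower_triangular_mats n R)"
proof (rule inj_onI)
  fix L M :: "'a mat"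
  assume L: "L \<in> lower_triangular_mats n R" and M: "M \<in> lower_triangular_mats n R"
    and eq: "L * transpose_mat L = M * transpose_mat M"
  have Lc: "L \<in> carrier_mat n n" "lower_triangular L" "\<And>i. i < n \<Longrightarrow> L $$ (i, i) \<in> R"
    and Mc: "M \<in> carrier_mat n n" "lower_triangular M" "\<And>i. i < n \<Longrightarrow> M $$ (i, i) \<in> R"
    using L M by (auto simp: lower_triangular_mats_def)
  have col: "\<forall>i<n. L $$ (i, j) = M $$ (i, j)" if "j < n" for j
    using that
  proof (induction j rule: less_induct)
    case (less j)
    have prod: "L $$ (i, j) * L $$ (j, j) = M $$ (i, j) * M $$ (j, j)" if "i < n" for i
    proof -
      have "(\<Sum>k<j. L $$ (i, k) * L $$ (j, k)) = (\<Sum>k<j. M $$ (i, k) * M $$ (j, k))"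
        using less that by (intro sum.cong) auto
      then show ?thesis
        using arg_cong[OF eq, of "\<lambda>A. A $$ (i, j)"] that less.prems
          mult_transpose_index_lower_triangular[OF Lc(1,2)]
          mult_transpose_index_lower_triangular[OF Mc(1,2)]
        by simp
    qed
    have diag: "L $$ (j, j) = M $$ (j, j)"
      using prod[OF less.prems] inj_onD[OF inj _ Lc(3) Mc(3)] less.prems
      by (simp add: power2_eq_square)
    moreover have "M $$ (j, j) \<noteq> 0"
      using Mc(3)[OF less.prems] zero by auto
    ultimately show ?case using prod by simp
  qed
  show "L = M"
    using Lc(1) Mc(1) col by (intro eq_matI) auto
qed

section \<open>Invertibility, and factors with diagonal in \<open>R\<close>\<close>

lemma det_nonzero_imp_GL:
  fixes A :: "'a::field mat"
  assumes A: "A \<in> carrier_mat n n" and det: "det A \<noteq> 0"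
  shows "A \<in> GL n"
proof -
  obtain B where "B \<in> carrier_mat n n" "B * A = 1\<^sub>m n" "A * B = 1\<^sub>m n"
    using det_non_zero_imp_unit[OF A det, of "()"] by (auto simp: Units_def ring_mat_def)
  then show ?thesis
    using A by (auto simp: GL_def invertible_mat_def inverts_mat_def)
qed

lemma det_lower_triangular_nonzero:
  fixes L :: "'a::field mat"
  assumes L: "L \<in> carrier_mat n n" "lower_triangular L"
    and diag: "\<And>i. i < n \<Longrightarrow> L $$ (i, i) \<noteq> 0"
  shows "det L \<noteq> 0"
proof -
  have "det L = prod_list (diag_mat L)"
    using L by (intro det_lower_triangular[of n]) (auto simp: lower_triangular_def)
  then show ?thesis
    using L diag by (auto simp: diag_mat_def prod_list_zero_iff)
qed

lemma symmetric_mult_transpose: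
  fixes L :: "'a::comm_ring_1 mat"
  assumes "L \<in> carrier_mat n n"
  shows "symmetric_matrix (L * transpose_mat L)"
  using assms by (simp add: symmetric_matrix_def transpose_mult[of _ n n _ n])

text \<open>Here \<open>M\<close> is \<open>L\<close> times the diagonal matrix of the
  \<open>s k\<close>, which is its own inverse and its own transpose, so it cancels in the
  product.\<close>

lemma mult_transpose_sign_columns:
  fixes L :: "'a::comm_ring_1 mat"
  assumes L: "L \<in> carrier_mat n n" and s: "\<And>k. k < n \<Longrightarrow> s k * s k = 1"
  defines "M \<equiv> mat n n (\<lambda>(i, j). L $$ (i, j) * s j)"
  shows "M * transpose_mat M = L * transpose_mat L"
proof (rule eq_matI)
  fix i j assume "i < dim_row (L * transpose_mat L)" "j < dim_col (L * transpose_mat L)"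
  then have ij: "i < n" "j < n" using L by auto
  have "(M * transpose_mat M) $$ (i, j) = (\<Sum>k<n. (L $$ (i, k) * s k) * (L $$ (j, k) * s k))"
    using ij by (simp add: M_def scalar_prod_def lessThan_atLeast0)
  also have "\<dots> = (\<Sum>k<n. L $$ (i, k) * L $$ (j, k) * (s k * s k))"
    by (simp add: mult_ac)
  also have "\<dots> = (\<Sum>k<n. L $$ (i, k) * L $$ (j, k))"
    using s by simp
  also have "\<dots> = (L * transpose_mat L) $$ (i, j)"
    using ij L by (simp add: scalar_prod_def lessThan_atLeast0)
  finally show "(M * transpose_mat M) $$ (i, j) = (L * transpose_mat L) $$ (i, j)" .
qed (use L in \<open>auto simp: M_def\<close>)

lemma positive_definite_type2_eq_image:
  fixes R :: "'a::field set"
  assumes pos: "\<And>r. r \<in> R \<Longrightarrow> positive r" and R: "\<And>x. positive x \<Longrightarrow> x \<in> R \<or> - x \<in> R"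
  shows "{A. positive_definite_type2 n A} =
    (\<lambda>L. L * transpose_mat L) ` lower_triangular_mats n R"
proof (intro equalityI subsetI)
  fix A :: "'a mat"
  assume "A \<in> {A. positive_definite_type2 n A}"
  then obtain L where L: "L \<in> carrier_mat n n" "lower_triangular L"
      "\<And>i. i < n \<Longrightarrow> positive (L $$ (i, i))" and A: "A = L * transpose_mat L"
    by (auto simp: positive_definite_type2_def GL_def)
  \<comment> \<open>Flip exactly the columns whose diagonal entry lies outside \<open>R\<close>; by
    assumption its negative then lies in \<open>R\<close>.\<close>
  define s :: "nat \<Rightarrow> 'a" where "s k = (if L $$ (k, k) \<in> R then 1 else -1)" for k
  define M where "M = mat n n (\<lambda>(i, j). L $$ (i, j) * s j)"
  have "M \<in> lower_triangular_mats n R"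
    using L R by (auto simp: lower_triangular_mats_def lower_triangular_def M_def s_def)
  moreover have "A = M * transpose_mat M"
    unfolding A M_def using L(1)
    by (intro mult_transpose_sign_columns[symmetric]) (auto simp: s_def)
  ultimately show "A \<in> (\<lambda>L. L * transpose_mat L) ` lower_triangular_mats n R"
    by (rule rev_image_eqI)
next
  fix A :: "'a mat"
  assume "A \<in> (\<lambda>L. L * transpose_mat L) ` lower_triangular_mats n R"
  then obtain L where L: "L \<in> carrier_mat n n" "lower_triangular L"
      "\<And>i. i < n \<Longrightarrow> L $$ (i, i) \<in> R" and A: "A = L * transpose_mat L"
    by (auto simp: lower_triangular_mats_def)
  have det: "det L \<noteq> 0"
    using L pos by (intro det_lower_triangular_nonzero) (auto simp: positive_def)
  then have "L \<in> GL n"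
    using L(1) by (intro det_nonzero_imp_GL)
  \<comment> \<open>The determinant of \<open>A\<close> is the square of
    \<open>det L\<close>.\<close>
  moreover have "A \<in> GL n"
    unfolding A using L(1) det
    by (intro det_nonzero_imp_GL) (auto simp: det_mult[of _ n] det_transpose[of _ n])
  ultimately show "A \<in> {A. positive_definite_type2 n A}"
    using L pos A symmetric_mult_transpose
    unfolding positive_definite_type2_def by blast
qed

theorem theorem3p7:
  fixes q n :: nat
  assumes q: "CARD('a::{field,finite}) = q"
    and indef: "indefinite_field TYPE('a)"
    and n: "n \<ge> 1"
  shows "real (pd2 TYPE('a) n) = real q ^ ((n ^ 2 - n) div 2) * ((real q - 1) / 4) ^ n"
proof -
  obtain R :: "'a set" where R: "\<And>r. r \<in> R \<Longrightarrow> positive r" "inj_on (\<lambda>x. x\<^sup>2) R"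
    "\<And>x. positive x \<Longrightarrow> x \<in> R \<or> - x \<in> R" "4 * card R = CARD('a) - 1"
    using ex_positive_square_transversal[OF indef] by blast
  have "0 \<notin> R" using R(1) by (auto simp: positive_def)
  have "pd2 TYPE('a) n = card ((\<lambda>L. L * transpose_mat L) ` lower_triangular_mats n R)"
    using positive_definite_type2_eq_image[OF R(1,3)] by (simp add: pd2_def)
  also have "\<dots> = card (lower_triangular_mats n R)"
    using \<open>0 \<notin> R\<close> R(2) by (intro card_image inj_on_mult_transpose_lower_triangular_mats)
  also have "\<dots> = q ^ ((n ^ 2 - n) div 2) * card R ^ n"
    unfolding card_lower_triangular_mats q
    by (simp add: power2_eq_square diff_mult_distrib2)
  finally have "real (pd2 TYPE('a) n) = real q ^ ((n ^ 2 - n) div 2) * real (card R) ^ n"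
    by simp
  \<comment> \<open>This bound lets the natural number subtraction \<open>q - 1\<close> pass to the
    reals.\<close>
  moreover have "q \<ge> 1" using q zero_less_card_finite[where 'a='a] by simp
  then have "real (card R) = (real q - 1) / 4"
    using arg_cong[OF R(4), of real] q by (simp add: of_nat_diff)
  ultimately show ?thesis by simp
qed

end
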